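(* Let $K/F$ be a field extension, $V$ a vector space over $K$, $\beta:V\times V\to K$ a reflexive sesquilinear form which is alternating, symmetric or hermitian, and $L:K\to F$ an $F$-linear function which is not identically zero. When $\beta$ is hermitian let $\sigma$ be its associated field automorphism of order $2$ and assume $\sigma(F)=F$. Regard $V$ as a vector space over $F$ and let $L\beta=L\circ\beta:V\times V\to F$. Then the type of $L\beta$ is as follows: (1) If $\beta$ is alternating then $L\beta$ is alternating. (2) If $\beta$ is symmetric then $L\beta$ is symmetric. (3) If $\operatorname{char}K=2$, $K$ is finite and $\beta$ is symmetric and not alternating, then $L\beta$ is symmetric and not alternating. (4) If $\beta$ is hermitian and $F\not\subseteq \mathrm{Fix}(\sigma)$, then (a) $L\beta$ is hermitian if and only if $L\sigma=\sigma L$; (b) $L\beta$ is atypical if and only if $L\sigma\neq\sigma L$. (5) If $\beta$ is hermitian and $F\subseteq\mathrm{Fix}(\sigma)$, then (a) $L\beta$ is symmetric if and only if $L\sigma=L$; (b) $L\beta$ is alternating if and only if either $\operatorname{char}K\neq2$ and $L\sigma=-L$, or $\operatorname{char}K=2$ and $L\sigma=L$; (c) $L\beta$ is atypical if and only if $L\sigma\neq\pm L$ (that is, $L\sigma\ne L$ and $L\sigma\neq -L$).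
   Context: A $\sigma$-sesquilinear form is biadditive with $\beta(\lambda u,\mu v)=\lambda\,\sigma(\mu)\,\beta(u,v)$; it is reflexive if $\beta(u,v)=0$ implies $\beta(v,u)=0$. It is alternating if it is bilinear ($\sigma=1$) with $\beta(x,x)=0$ for all $x$; symmetric if it is bilinear with $\beta(u,v)=\beta(v,u)$ for all $u,v$; hermitian if $\sigma$ has order $2$ and $\beta(u,v)=\sigma(\beta(v,u))$ for all $u,v$. $\mathrm{Fix}(\sigma)$ is the fixed field of $\sigma$ in $K$. $L\beta$ is a sesquilinear form over $F$ with respect to $\sigma|_F$ (bilinear when $F\subseteq \mathrm{Fix}(\sigma)$), and it is hermitian when $\sigma|_F$ has order 2 and $L\beta(u,v)=\sigma(L\beta(v,u))$ for all $u,v$. A form is called atypical if it is not alternating, not symmetric and not hermitian. Here $L\sigma$ and $\sigma L$ denote the compositions $x\mapsto L(\sigma(x))$ and $x\mapsto\sigma(L(x))$ on $K$.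
   Formalization: In items (4) and (5) the hermitian form β is additionally assumed not to be identically zero; for β = 0 the form Lβ is zero whatever L is, so the stated equivalences fail. *)

theory Defs
  imports "HOL-Algebra.Algebra"
begin

text \<open>
  Forms are functions on a module over a field, considered on the carriers only. For a
  subfield \<open>F\<close> of \<open>K\<close>, the space \<open>V\<close> regarded over \<open>F\<close> is the same record \<open>V\<close> with scalar ring
  \<open>K\<lparr>carrier := F\<rparr>\<close>, so the definitions below apply to forms over \<open>K\<close> and over \<open>F\<close> alike; the
  restriction of \<open>\<sigma>\<close> to \<open>F\<close> needs no separate notation.
\<close>

text \<open>\<open>group.ord\<close> is \<open>0\<close> on elements of infinite order, hence so is this in characteristic zero.\<close>

definition characteristic :: "('a, 'm) ring_scheme \<Rightarrow> nat" where
  "characteristic R = group.ord (add_monoid R) \<one>\<^bsub>R\<^esub>"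

definition fixed_field :: "('a, 'm) ring_scheme \<Rightarrow> ('a \<Rightarrow> 'a) \<Rightarrow> 'a set" where
  "fixed_field R \<sigma> = {x \<in> carrier R. \<sigma> x = x}"

definition automorphism_order_two :: "('a, 'm) ring_scheme \<Rightarrow> ('a \<Rightarrow> 'a) \<Rightarrow> bool" where
  "automorphism_order_two R \<sigma> \<longleftrightarrow>
     \<sigma> \<in> ring_iso R R \<and>
     (\<forall>x\<in>carrier R. \<sigma> (\<sigma> x) = x) \<and>
     (\<exists>x\<in>carrier R. \<sigma> x \<noteq> x)"

definition sesquilinear_form ::
  "('a, 'm) ring_scheme \<Rightarrow> ('a, 'b, 'n) module_scheme \<Rightarrow> ('a \<Rightarrow> 'a) \<Rightarrow> ('b \<Rightarrow> 'b \<Rightarrow> 'a) \<Rightarrow> bool" where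
  "sesquilinear_form R V \<sigma> \<beta> \<longleftrightarrow>
     \<sigma> \<in> ring_iso R R \<and>
     (\<forall>u\<in>carrier V. \<forall>v\<in>carrier V. \<beta> u v \<in> carrier R) \<and>
     (\<forall>u\<in>carrier V. \<forall>v\<in>carrier V. \<forall>w\<in>carrier V. \<beta> (u \<oplus>\<^bsub>V\<^esub> v) w = \<beta> u w \<oplus>\<^bsub>R\<^esub> \<beta> v w) \<and>
     (\<forall>u\<in>carrier V. \<forall>v\<in>carrier V. \<forall>w\<in>carrier V. \<beta> u (v \<oplus>\<^bsub>V\<^esub> w) = \<beta> u v \<oplus>\<^bsub>R\<^esub> \<beta> u w) \<and>
     (\<forall>a\<in>carrier R. \<forall>b\<in>carrier R. \<forall>u\<in>carrier V. \<forall>v\<in>carrier V.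
        \<beta> (a \<odot>\<^bsub>V\<^esub> u) (b \<odot>\<^bsub>V\<^esub> v) = a \<otimes>\<^bsub>R\<^esub> \<sigma> b \<otimes>\<^bsub>R\<^esub> \<beta> u v)"

definition bilinear_form ::
  "('a, 'm) ring_scheme \<Rightarrow> ('a, 'b, 'n) module_scheme \<Rightarrow> ('b \<Rightarrow> 'b \<Rightarrow> 'a) \<Rightarrow> bool" where
  "bilinear_form R V \<beta> \<longleftrightarrow> sesquilinear_form R V (\<lambda>x. x) \<beta>"

definition reflexive_form ::
  "('a, 'm) ring_scheme \<Rightarrow> ('a, 'b, 'n) module_scheme \<Rightarrow> ('b \<Rightarrow> 'b \<Rightarrow> 'a) \<Rightarrow> bool" where
  "reflexive_form R V \<beta> \<longleftrightarrow>
     (\<forall>u\<in>carrier V. \<forall>v\<in>carrier V. \<beta> u v = \<zero>\<^bsub>R\<^esub> \<longrightarrow> \<beta> v u = \<zero>\<^bsub>R\<^esub>)"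

text \<open>
  The zero form is hermitian for every involution \<open>\<sigma>\<close>, and composing it with any linear \<open>L\<close> gives
  the zero form again. So the type of \<open>L \<circ> \<beta>\<close> says nothing about \<open>L\<close> unless \<open>\<beta>\<close> is nonzero.
\<close>

definition nonzero_form ::
  "('a, 'm) ring_scheme \<Rightarrow> ('a, 'b, 'n) module_scheme \<Rightarrow> ('b \<Rightarrow> 'b \<Rightarrow> 'a) \<Rightarrow> bool" where
  "nonzero_form R V \<beta> \<longleftrightarrow> (\<exists>u\<in>carrier V. \<exists>v\<in>carrier V. \<beta> u v \<noteq> \<zero>\<^bsub>R\<^esub>)"

definition alternating_form ::
  "('a, 'm) ring_scheme \<Rightarrow> ('a, 'b, 'n) module_scheme \<Rightarrow> ('b \<Rightarrow> 'b \<Rightarrow> 'a) \<Rightarrow> bool" where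
  "alternating_form R V \<beta> \<longleftrightarrow>
     bilinear_form R V \<beta> \<and> (\<forall>x\<in>carrier V. \<beta> x x = \<zero>\<^bsub>R\<^esub>)"

definition symmetric_form ::
  "('a, 'm) ring_scheme \<Rightarrow> ('a, 'b, 'n) module_scheme \<Rightarrow> ('b \<Rightarrow> 'b \<Rightarrow> 'a) \<Rightarrow> bool" where
  "symmetric_form R V \<beta> \<longleftrightarrow>
     bilinear_form R V \<beta> \<and> (\<forall>u\<in>carrier V. \<forall>v\<in>carrier V. \<beta> u v = \<beta> v u)"

definition hermitian_form ::
  "('a, 'm) ring_scheme \<Rightarrow> ('a, 'b, 'n) module_scheme \<Rightarrow> ('a \<Rightarrow> 'a) \<Rightarrow> ('b \<Rightarrow> 'b \<Rightarrow> 'a) \<Rightarrow> bool" where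
  "hermitian_form R V \<sigma> \<beta> \<longleftrightarrow>
     sesquilinear_form R V \<sigma> \<beta> \<and>
     automorphism_order_two R \<sigma> \<and>
     (\<forall>u\<in>carrier V. \<forall>v\<in>carrier V. \<beta> u v = \<sigma> (\<beta> v u))"

definition atypical_form ::
  "('a, 'm) ring_scheme \<Rightarrow> ('a, 'b, 'n) module_scheme \<Rightarrow> ('a \<Rightarrow> 'a) \<Rightarrow> ('b \<Rightarrow> 'b \<Rightarrow> 'a) \<Rightarrow> bool" where
  "atypical_form R V \<sigma> \<beta> \<longleftrightarrow>
     sesquilinear_form R V \<sigma> \<beta> \<and>
     \<not> alternating_form R V \<beta> \<and>
     \<not> symmetric_form R V \<beta> \<and>
     \<not> hermitian_form R V \<sigma> \<beta>"

definition linear_functional ::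
  "('a, 'm) ring_scheme \<Rightarrow> 'a set \<Rightarrow> ('a \<Rightarrow> 'a) \<Rightarrow> bool" where
  "linear_functional K F L \<longleftrightarrow>
     L \<in> carrier K \<rightarrow> F \<and>
     (\<forall>x\<in>carrier K. \<forall>y\<in>carrier K. L (x \<oplus>\<^bsub>K\<^esub> y) = L x \<oplus>\<^bsub>K\<^esub> L y) \<and>
     (\<forall>a\<in>F. \<forall>x\<in>carrier K. L (a \<otimes>\<^bsub>K\<^esub> x) = a \<otimes>\<^bsub>K\<^esub> L x)"

end

(*
  A nonzero form takes every value of K, so an identity relating L b(u,v) and L b(v,u) for all u, v
  is an identity for L on all of K. In the hermitian case only one direction needs more: L s = -L, for the
  involution s, makes L b alternating: b(x,x) is fixed by s, hence b(x,x) = z + s(z) for some z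
  (in every characteristic, since the trace of s is not zero), and so L b(x,x) = L z - L z = 0.
  In (3), b(c x, c x) = c^2 b(x,x) takes every value because every element of K is a square.
*)

theory Submission
  imports Defs
begin

section \<open>Fields: characteristic two, traces of an involution, restriction to a
  subfield\<close>

context field
begin

text \<open>The additive order of \<one> divides 2 exactly when \<one> \<oplus> \<one> = \<zero>. It
  is never 1, since \<one> \<noteq> \<zero> in a field, so a divisor of 2 must be 2 itself.\<close>

lemma characteristic_eq_2_iff: "characteristic R = 2 \<longleftrightarrow> \<one> \<oplus> \<one> = \<zero>"
proof -
  let ?ord = "group.ord (add_monoid R)"
  have one: "\<one> \<in> carrier (add_monoid R)" by simp
  have pow2: "\<one> [^]\<^bsub>add_monoid R\<^esub> (2::nat) = \<one> \<oplus> \<one>"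
    by (simp add: numeral_2_eq_2)
  have "\<one> \<oplus> \<one> = \<zero> \<longleftrightarrow> ?ord \<one> dvd 2"
    using group.pow_eq_id[OF a_group one, of 2] pow2 by simp
  also have "\<dots> \<longleftrightarrow> ?ord \<one> = 2"
  proof -
    have "?ord \<one> \<noteq> 1"
      using group.ord_eq_1[OF a_group one] by simp
    then show ?thesis
      using two_is_prime_nat by (metis dvd_refl prime_nat_iff)
  qed
  finally show ?thesis
    by (simp add: characteristic_def)
qed

lemma add_self_char2:
  assumes "characteristic R = 2" and "x \<in> carrier R"
  shows "x \<oplus> x = \<zero>"
proof -
  have "x \<oplus> x = (\<one> \<oplus> \<one>) \<otimes> x"
    using assms(2) by (simp add: l_distr)
  then show ?thesis
    using assms by (simp add: characteristic_eq_2_iff)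
qed

lemma minus_eq_self_char2:
  assumes "characteristic R = 2" and "x \<in> carrier R"
  shows "\<ominus> x = x"
  using add_self_char2[OF assms] assms(2) by (simp add: minus_equality)

text \<open>In characteristic two a^2 - b^2 = (a - b)^2, so squaring is injective, and an injective
  self-map of a finite set is onto.\<close>

lemma square_surj_char2:
  assumes "characteristic R = 2" and "finite (carrier R)" and "y \<in> carrier R"
  shows "\<exists>x\<in>carrier R. x \<otimes> x = y"
proof -
  have "inj_on (\<lambda>x. x \<otimes> x) (carrier R)"
  proof (rule inj_onI)
    fix a b assume ab: "a \<in> carrier R" "b \<in> carrier R" "a \<otimes> a = b \<otimes> b"
    have "(a \<ominus> b) \<otimes> (a \<oplus> b) = a \<otimes> a \<ominus> b \<otimes> b"
      using ab(1,2) by algebra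
    then have "(a \<ominus> b) \<otimes> (a \<oplus> b) = \<zero>"
      using ab by (simp add: a_minus_def r_neg)
    moreover have "a \<oplus> b = a \<ominus> b"
      using assms(1) ab(2) by (simp add: a_minus_def minus_eq_self_char2)
    ultimately have "a \<ominus> b = \<zero>"
      using integral[of "a \<ominus> b" "a \<ominus> b"] ab(1,2) by auto
    then show "a = b"
      using ab(1,2) by simp
  qed
  moreover have "(\<lambda>x. x \<otimes> x) ` carrier R \<subseteq> carrier R" by auto
  ultimately have "(\<lambda>x. x \<otimes> x) ` carrier R = carrier R"
    using assms(2) by (intro endo_inj_surj)
  then have "y \<in> (\<lambda>x. x \<otimes> x) ` carrier R"
    using assms(3) by simp
  then show ?thesis by blast
qed

text \<open>Some \<open>a\<close> has trace t = a + \<sigma>(a) \<noteq> 0. Both t and y are fixed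
  by \<sigma>, hence so is s = y/t, and s passes through the trace: s a has trace s t = y. Nothing
  is divided by 2, so the characteristic is arbitrary.\<close>

lemma fixed_by_involution_is_trace:
  fixes \<sigma> :: "'a \<Rightarrow> 'a"
  assumes "automorphism_order_two R \<sigma>" and y: "y \<in> carrier R" "\<sigma> y = y"
  shows "\<exists>z\<in>carrier R. y = z \<oplus> \<sigma> z"
proof -
  have iso: "\<sigma> \<in> ring_iso R R" and inv: "\<And>x. x \<in> carrier R \<Longrightarrow> \<sigma> (\<sigma> x) = x"
    using assms(1) by (auto simp: automorphism_order_two_def)
  interpret S: ring_hom_ring R R \<sigma>
    using iso by (intro ring_hom_ringI2) (auto simp: ring_iso_def ring_axioms)
  \<comment> \<open>If every trace vanished, \<sigma> would be negation. Since \<sigma> also fixes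
    \<one>, this forces characteristic two, where negation is the identity, contradicting that
    \<sigma> moves some element.\<close>
  have "\<exists>a\<in>carrier R. a \<oplus> \<sigma> a \<noteq> \<zero>"
  proof (rule ccontr)
    assume "\<not> ?thesis"
    then have tr0: "\<And>a. a \<in> carrier R \<Longrightarrow> a \<oplus> \<sigma> a = \<zero>" by blast
    then have neg: "\<sigma> a = \<ominus> a" if "a \<in> carrier R" for a
      using that by (metis S.hom_closed a_comm minus_equality)
    have "\<one> \<oplus> \<one> = \<zero>"
      using tr0[of \<one>] by simp
    then have "\<sigma> a = a" if "a \<in> carrier R" for a
      using neg that by (simp add: minus_eq_self_char2 characteristic_eq_2_iff)
    then show False
      using assms(1) by (auto simp: automorphism_order_two_def)
  qed
  then obtain a where a: "a \<in> carrier R" and t0: "a \<oplus> \<sigma> a \<noteq> \<zero>" by blast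
  \<comment> \<open>\<sigma> swaps the two summands, so \<open>t\<close> is fixed.\<close>
  define t where "t = a \<oplus> \<sigma> a"
  have t: "t \<in> carrier R" "t \<in> Units R" "\<sigma> t = t"
    using a t0 inv by (auto simp: t_def field_Units a_comm)
  define s where "s = y \<otimes> inv t"
  have s: "s \<in> carrier R" using y t by (simp add: s_def)
  \<comment> \<open>Applying \<sigma> to s t = y, where t and y are fixed, gives \<sigma>(s) t = s
    t; cancelling t then shows that s is fixed, without computing \<sigma> of an inverse.\<close>
  have "\<sigma> s \<otimes> t = s \<otimes> t"
  proof -
    have st: "s \<otimes> t = y"
      using y t by (simp add: s_def m_assoc)
    then have "\<sigma> s \<otimes> \<sigma> t = \<sigma> y"
      using s t(1) by (metis S.hom_mult)
    then show ?thesis using st t(3) y(2) by simp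
  qed
  then have "\<sigma> s = s"
    using s t t0 by (simp add: m_rcancel t_def)
  then have "(s \<otimes> a) \<oplus> \<sigma> (s \<otimes> a) = s \<otimes> t"
    using s a by (simp add: t_def r_distr)
  also have "\<dots> = y"
    using y t by (simp add: s_def m_assoc)
  finally show ?thesis
    using s a by (metis m_closed)
qed

end

text \<open>Sesquilinearity over \<open>F\<close> includes that \<sigma> is an automorphism of
  \<open>F\<close>. Injectivity and the ring laws are inherited from \<open>R\<close>; surjectivity
  is why the image must equal \<open>F\<close> and not merely lie in it.\<close>

lemma ring_iso_subcarrier:
  assumes "\<sigma> \<in> ring_iso R R" and "F \<subseteq> carrier R" and "\<sigma> ` F = F"
  shows "\<sigma> \<in> ring_iso (R\<lparr>carrier := F\<rparr>) (R\<lparr>carrier := F\<rparr>)"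
proof -
  have "inj_on \<sigma> F"
    using assms(1,2) by (auto simp: ring_iso_def bij_betw_def intro: inj_on_subset)
  moreover have "\<sigma> x \<in> F" if "x \<in> F" for x
    using assms(3) that by blast
  ultimately show ?thesis
    using assms by (simp add: ring_iso_def ring_hom_def bij_betw_def subset_iff)
qed

section \<open>Scaling and the values of a sesquilinear form\<close>

context module
begin

text \<open>The definition scales both arguments at once; taking \<one>, which \<sigma> fixes, as
  the second scalar isolates the first.\<close>

lemma sesquilinear_form_smult_left:
  fixes \<sigma> :: "'a \<Rightarrow> 'a"
  assumes "sesquilinear_form R M \<sigma> \<beta>" "a \<in> carrier R" "u \<in> carrier M" "v \<in> carrier M"
  shows "\<beta> (a \<odot>\<^bsub>M\<^esub> u) v = a \<otimes> \<beta> u v"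
proof -
  have "\<sigma> \<one> = \<one>"
    using assms(1) by (auto simp: sesquilinear_form_def ring_iso_def ring_hom_def)
  moreover have "\<beta> (a \<odot>\<^bsub>M\<^esub> u) (\<one> \<odot>\<^bsub>M\<^esub> v) = a \<otimes> \<sigma> \<one> \<otimes> \<beta> u v"
    using assms one_closed unfolding sesquilinear_form_def by blast
  ultimately show ?thesis
    using assms by simp
qed

end

text \<open>If \<beta>(u,v) \<noteq> 0, then rescaling \<open>u\<close> by c / \<beta>(u,v) moves
  the value to \<open>c\<close>, by linearity in the first argument.\<close>

lemma (in field) nonzero_form_surj:
  fixes \<sigma> :: "'a \<Rightarrow> 'a"
  assumes "module R V" "sesquilinear_form R V \<sigma> \<beta>" "nonzero_form R V \<beta>" "c \<in> carrier R"
  shows "\<exists>u\<in>carrier V. \<exists>v\<in>carrier V. \<beta> u v = c"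
proof -
  interpret V: module R V by fact
  obtain u v where uv: "u \<in> carrier V" "v \<in> carrier V" "\<beta> u v \<noteq> \<zero>"
    using assms(3) by (auto simp: nonzero_form_def)
  have b: "\<beta> u v \<in> carrier R" "\<beta> u v \<in> Units R"
    using assms(2) uv by (auto simp: sesquilinear_form_def field_Units)
  have "\<beta> ((c \<otimes> inv \<beta> u v) \<odot>\<^bsub>V\<^esub> u) v = c \<otimes> inv \<beta> u v \<otimes> \<beta> u v"
    using V.sesquilinear_form_smult_left[OF assms(2)] assms(4) uv b by simp
  also have "\<dots> = c"
    using assms(4) b by (simp add: m_assoc)
  finally show ?thesis
    using assms(4) uv(1,2) b(2) by (meson V.smult_closed Units_inv_closed m_closed)
qed

section \<open>Composition with a linear functional; alternating and symmetric forms\<close>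

locale form_functional = field K + V: module K V
  for K :: "('a, 'm) ring_scheme" (structure) and V :: "('a, 'b, 'n) module_scheme" +
  fixes F :: "'a set" and L :: "'a \<Rightarrow> 'a"
  assumes subfield: "subfield F K"
    and linear: "linear_functional K F L"
    and nontrivial: "\<exists>x\<in>carrier K. L x \<noteq> \<zero>"
begin

abbreviation K\<^sub>F :: "('a, 'm) ring_scheme" where
  "K\<^sub>F \<equiv> K\<lparr>carrier := F\<rparr>"

lemma F_subset: "F \<subseteq> carrier K"
  using subfield by (simp add: subfieldE(3))

lemma L_in_F: "x \<in> carrier K \<Longrightarrow> L x \<in> F"
  using linear by (auto simp: linear_functional_def)

lemma L_closed [simp]: "x \<in> carrier K \<Longrightarrow> L x \<in> carrier K"
  using L_in_F F_subset by auto

lemma L_add: "x \<in> carrier K \<Longrightarrow> y \<in> carrier K \<Longrightarrow> L (x \<oplus> y) = L x \<oplus> L y"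
  using linear by (simp add: linear_functional_def)

lemma L_smult: "a \<in> F \<Longrightarrow> x \<in> carrier K \<Longrightarrow> L (a \<otimes> x) = a \<otimes> L x"
  using linear by (simp add: linear_functional_def)

lemma L_zero: "L \<zero> = \<zero>"
  using L_add[of \<zero> \<zero>] by simp

text \<open>For a, b in \<open>F\<close> the factor a \<sigma>(b) lies again in \<open>F\<close>,
  because \<sigma> preserves \<open>F\<close>; hence the \<open>F\<close>-linear \<open>L\<close>
  lets it pass.\<close>

lemma L_comp_sesquilinear:
  fixes \<sigma> :: "'a \<Rightarrow> 'a"
  assumes sf: "sesquilinear_form K V \<sigma> \<beta>" and "\<sigma> ` F = F"
  shows "sesquilinear_form K\<^sub>F V \<sigma> (\<lambda>u v. L (\<beta> u v))"
proof -
  have mult: "a \<otimes> b \<in> F" if "a \<in> F" "b \<in> F" for a b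
    using subfield that by (simp add: subfieldE(1) subringE(6))
  have "\<sigma> b \<in> F" if "b \<in> F" for b
    using assms(2) that by auto
  then show ?thesis
    using sf F_subset ring_iso_subcarrier[OF _ F_subset assms(2)] mult
    unfolding sesquilinear_form_def by (simp add: L_in_F L_add L_smult subset_iff)
qed

lemma L_comp_bilinear:
  "bilinear_form K V \<beta> \<Longrightarrow> bilinear_form K\<^sub>F V (\<lambda>u v. L (\<beta> u v))"
  unfolding bilinear_form_def by (rule L_comp_sesquilinear) auto

lemma L_comp_alternating:
  "alternating_form K V \<beta> \<Longrightarrow> alternating_form K\<^sub>F V (\<lambda>u v. L (\<beta> u v))"
  by (simp add: alternating_form_def L_comp_bilinear L_zero)

lemma L_comp_symmetric:
  "symmetric_form K V \<beta> \<Longrightarrow> symmetric_form K\<^sub>F V (\<lambda>u v. L (\<beta> u v))"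
  by (simp add: symmetric_form_def L_comp_bilinear)

lemma L_comp_not_alternating_char2:
  assumes "characteristic K = 2" "finite (carrier K)"
    and "symmetric_form K V \<beta>" "\<not> alternating_form K V \<beta>"
  shows "\<not> alternating_form K\<^sub>F V (\<lambda>u v. L (\<beta> u v))"
proof -
  have bil: "sesquilinear_form K V (\<lambda>x. x) \<beta>"
    using assms(3) by (simp add: symmetric_form_def bilinear_form_def)
  obtain x where x: "x \<in> carrier V" "\<beta> x x \<noteq> \<zero>"
    using assms(3,4) by (auto simp: symmetric_form_def alternating_form_def)
  have b: "\<beta> x x \<in> carrier K" "\<beta> x x \<in> Units K"
    using bil x by (auto simp: sesquilinear_form_def field_Units)
  obtain y where y: "y \<in> carrier K" "L y \<noteq> \<zero>"
    using nontrivial by blast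
  \<comment> \<open>\<open>c\<close> is a square root of y / \<beta>(x,x), so that \<beta>(c x, c x)
    is the value \<open>y\<close>, on which \<open>L\<close> does not vanish.\<close>
  obtain c where c: "c \<in> carrier K" "c \<otimes> c = y \<otimes> inv \<beta> x x"
    using square_surj_char2[OF assms(1,2), of "y \<otimes> inv \<beta> x x"] y b by auto
  have "\<beta> (c \<odot>\<^bsub>V\<^esub> x) (c \<odot>\<^bsub>V\<^esub> x) = c \<otimes> c \<otimes> \<beta> x x"
    using bil c(1) x(1) unfolding sesquilinear_form_def by blast
  also have "\<dots> = y"
    using b y(1) by (simp add: c(2) m_assoc)
  finally have "L (\<beta> (c \<odot>\<^bsub>V\<^esub> x) (c \<odot>\<^bsub>V\<^esub> x)) \<noteq> \<zero>"
    using y(2) by simp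
  moreover have "c \<odot>\<^bsub>V\<^esub> x \<in> carrier V"
    using c(1) x(1) by simp
  ultimately show ?thesis
    by (auto simp: alternating_form_def)
qed

end

section \<open>Composition of a nonzero hermitian form with a linear functional\<close>

locale hermitian_form_functional = form_functional K V F L
  for K :: "('a, 'm) ring_scheme" (structure) and V :: "('a, 'b, 'n) module_scheme" and F L +
  fixes \<sigma> :: "'a \<Rightarrow> 'a" and \<beta> :: "'b \<Rightarrow> 'b \<Rightarrow> 'a"
  assumes hermitian: "hermitian_form K V \<sigma> \<beta>"
    and nonzero: "nonzero_form K V \<beta>"
    and F_stable: "\<sigma> ` F = F"
begin

abbreviation L\<beta> where "L\<beta> \<equiv> \<lambda>u v. L (\<beta> u v)"

lemma sesquilinear: "sesquilinear_form K V \<sigma> \<beta>"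
  and involution: "automorphism_order_two K \<sigma>"
  using hermitian by (auto simp: hermitian_form_def)

lemma \<sigma>_\<beta> [simp]: "u \<in> carrier V \<Longrightarrow> v \<in> carrier V \<Longrightarrow> \<sigma> (\<beta> u v) = \<beta> v u"
  using hermitian unfolding hermitian_form_def by metis

lemma \<beta>_closed [simp]: "u \<in> carrier V \<Longrightarrow> v \<in> carrier V \<Longrightarrow> \<beta> u v \<in> carrier K"
  using sesquilinear by (auto simp: sesquilinear_form_def)

lemma \<sigma>_closed [simp]: "x \<in> carrier K \<Longrightarrow> \<sigma> x \<in> carrier K"
  using involution by (auto simp: automorphism_order_two_def ring_iso_def ring_hom_def)

lemma \<sigma>_\<sigma> [simp]: "x \<in> carrier K \<Longrightarrow> \<sigma> (\<sigma> x) = x"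
  using involution by (auto simp: automorphism_order_two_def)

text \<open>The bridge from forms to functionals: since \<beta> takes every value in
  \<open>K\<close>, a condition on all \<beta>(u,v) is a condition on all of \<open>K\<close>. Each
  criterion below for the type of \<open>L\<beta>\<close> rests on it.\<close>

lemma ball_\<beta>_iff:
  "(\<forall>u\<in>carrier V. \<forall>v\<in>carrier V. P (\<beta> u v)) \<longleftrightarrow> (\<forall>x\<in>carrier K. P x)"
proof (intro iffI ballI)
  fix x assume P: "\<forall>u\<in>carrier V. \<forall>v\<in>carrier V. P (\<beta> u v)" and "x \<in> carrier K"
  then obtain u v where "u \<in> carrier V" "v \<in> carrier V" "\<beta> u v = x"
    using nonzero_form_surj[OF V.module_axioms sesquilinear nonzero] by blast
  then show "P x" using P by blast
qed simp

lemma L\<beta>_sesquilinear: "sesquilinear_form K\<^sub>F V \<sigma> L\<beta>"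
  using sesquilinear F_stable by (rule L_comp_sesquilinear)

text \<open>\<open>L\<beta>\<close> is always \<sigma>-sesquilinear over \<open>F\<close>. If it is
  also bilinear, a scalar b in the second argument comes out both as b and as \<sigma>(b), and a
  nonzero value of \<open>L\<beta>\<close> can be cancelled. If \<sigma> is the identity on
  \<open>F\<close>, the two notions agree.\<close>

lemma L\<beta>_bilinear_iff: "bilinear_form K\<^sub>F V L\<beta> \<longleftrightarrow> F \<subseteq> fixed_field K \<sigma>"
proof
  assume bil: "bilinear_form K\<^sub>F V L\<beta>"
  \<comment> \<open>If \<open>L\<close> vanished on all values of \<beta>, it would vanish on
    \<open>K\<close>.\<close>
  obtain u v where uv: "u \<in> carrier V" "v \<in> carrier V" "L (\<beta> u v) \<noteq> \<zero>"
    using nontrivial ball_\<beta>_iff[of "\<lambda>x. L x = \<zero>"] by blast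
  have one: "\<one> \<in> F"
    using subfield by (simp add: subfieldE(1) subringE(3))
  show "F \<subseteq> fixed_field K \<sigma>"
  proof
    fix b assume b: "b \<in> F"
    have F: "\<one> \<in> carrier K\<^sub>F" "b \<in> carrier K\<^sub>F"
      using b one by simp_all
    have "L\<beta> (\<one> \<odot>\<^bsub>V\<^esub> u) (b \<odot>\<^bsub>V\<^esub> v) = \<one> \<otimes>\<^bsub>K\<^sub>F\<^esub> b \<otimes>\<^bsub>K\<^sub>F\<^esub> L\<beta> u v"
      using bil F uv(1,2) unfolding bilinear_form_def sesquilinear_form_def by blast
    moreover have "L\<beta> (\<one> \<odot>\<^bsub>V\<^esub> u) (b \<odot>\<^bsub>V\<^esub> v) = \<one> \<otimes>\<^bsub>K\<^sub>F\<^esub> \<sigma> b \<otimes>\<^bsub>K\<^sub>F\<^esub> L\<beta> u v"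
      using L\<beta>_sesquilinear F uv(1,2) unfolding sesquilinear_form_def by blast
    ultimately have "b \<otimes> L (\<beta> u v) = \<sigma> b \<otimes> L (\<beta> u v)"
      using b F_subset by (simp add: subset_iff)
    then have "b = \<sigma> b"
      using b uv F_subset by (simp add: m_rcancel subset_iff)
    then show "b \<in> fixed_field K \<sigma>"
      using b F_subset by (auto simp: fixed_field_def)
  qed
next
  assume "F \<subseteq> fixed_field K \<sigma>"
  moreover have "(\<lambda>x. x) \<in> ring_iso K\<^sub>F K\<^sub>F"
    by (simp add: ring_iso_def ring_hom_def bij_betw_def)
  ultimately show "bilinear_form K\<^sub>F V L\<beta>"
    using L\<beta>_sesquilinear
    unfolding bilinear_form_def sesquilinear_form_def
    by (simp add: fixed_field_def subset_iff)
qed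

text \<open>The restriction of \<sigma> to \<open>F\<close> inherits \<sigma>^2 = 1, so it has order
  two exactly when it moves some element of \<open>F\<close>. The remaining condition is an identity
  on the values of \<beta>.\<close>

lemma L\<beta>_hermitian_iff:
  "hermitian_form K\<^sub>F V \<sigma> L\<beta> \<longleftrightarrow>
     \<not> F \<subseteq> fixed_field K \<sigma> \<and> (\<forall>x\<in>carrier K. L (\<sigma> x) = \<sigma> (L x))"
proof -
  have "automorphism_order_two K\<^sub>F \<sigma> \<longleftrightarrow> \<not> F \<subseteq> fixed_field K \<sigma>"
  proof -
    have "\<sigma> \<in> ring_iso K\<^sub>F K\<^sub>F"
      using involution F_subset F_stable by (simp add: automorphism_order_two_def ring_iso_subcarrier)
    moreover have "\<forall>x\<in>F. \<sigma> (\<sigma> x) = x"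
      using F_subset by (simp add: subset_iff)
    moreover have "F \<subseteq> fixed_field K \<sigma> \<longleftrightarrow> (\<forall>x\<in>F. \<sigma> x = x)"
      using F_subset unfolding fixed_field_def by blast
    ultimately show ?thesis
      by (simp add: automorphism_order_two_def)
  qed
  \<comment> \<open>The two sides differ by exchanging \<open>u\<close> and \<open>v\<close>, with
    \<beta>(v,u) rewritten as \<sigma>(\<beta>(u,v)).\<close>
  moreover have "(\<forall>u\<in>carrier V. \<forall>v\<in>carrier V. L (\<beta> u v) = \<sigma> (L (\<beta> v u))) \<longleftrightarrow>
      (\<forall>u\<in>carrier V. \<forall>v\<in>carrier V. L (\<sigma> (\<beta> u v)) = \<sigma> (L (\<beta> u v)))"
    by auto
  ultimately show ?thesis
    using ball_\<beta>_iff[of "\<lambda>x. L (\<sigma> x) = \<sigma> (L x)"] L\<beta>_sesquilinear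
    by (simp add: hermitian_form_def)
qed

text \<open>Exchanging the arguments of \<beta> applies \<sigma> to its value, so symmetry of
  \<open>L\<beta>\<close> says that \<open>L\<close> and L\<sigma> agree on the values of \<beta>,
  which fill \<open>K\<close>.\<close>

lemma L\<beta>_symmetric_iff:
  "symmetric_form K\<^sub>F V L\<beta> \<longleftrightarrow>
     F \<subseteq> fixed_field K \<sigma> \<and> (\<forall>x\<in>carrier K. L (\<sigma> x) = L x)"
proof -
  have "(\<forall>u\<in>carrier V. \<forall>v\<in>carrier V. L (\<beta> u v) = L (\<beta> v u)) \<longleftrightarrow>
      (\<forall>u\<in>carrier V. \<forall>v\<in>carrier V. L (\<sigma> (\<beta> u v)) = L (\<beta> u v))"
    by auto
  then show ?thesis
    using ball_\<beta>_iff[of "\<lambda>x. L (\<sigma> x) = L x"] L\<beta>_bilinear_iff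
    by (simp add: symmetric_form_def)
qed

text \<open>Polarization: expanding L\<beta>(u+v, u+v) = 0 leaves L\<beta>(v,u) + L\<beta>(u,v) = 0,
  and \<beta>(v,u) = \<sigma>(\<beta>(u,v)).\<close>

lemma L_\<sigma>_eq_neg_if_L\<beta>_alternating:
  assumes alt: "alternating_form K\<^sub>F V L\<beta>" and "x \<in> carrier K"
  shows "L (\<sigma> x) = \<ominus> L x"
proof -
  have "L (\<sigma> (\<beta> u v)) = \<ominus> L (\<beta> u v)" if uv: "u \<in> carrier V" "v \<in> carrier V" for u v
  proof -
    have 0: "L (\<beta> w w) = \<zero>" if "w \<in> carrier V" for w
      using alt that by (simp add: alternating_form_def)
    have "\<zero> = L (\<beta> (u \<oplus>\<^bsub>V\<^esub> v) (u \<oplus>\<^bsub>V\<^esub> v))"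
      using 0 uv by simp
    also have "\<dots> = (L (\<beta> u u) \<oplus> L (\<beta> v u)) \<oplus> (L (\<beta> u v) \<oplus> L (\<beta> v v))"
      using L\<beta>_sesquilinear uv by (simp add: sesquilinear_form_def)
    also have "\<dots> = L (\<beta> v u) \<oplus> L (\<beta> u v)"
      using 0 uv by simp
    finally show ?thesis
      using uv by (simp add: minus_equality)
  qed
  then show ?thesis
    using ball_\<beta>_iff[of "\<lambda>x. L (\<sigma> x) = \<ominus> L x"] assms(2) by blast
qed

lemma L\<beta>_alternating_iff:
  "alternating_form K\<^sub>F V L\<beta> \<longleftrightarrow>
     F \<subseteq> fixed_field K \<sigma> \<and> (\<forall>x\<in>carrier K. L (\<sigma> x) = \<ominus> L x)"
proof
  assume "alternating_form K\<^sub>F V L\<beta>"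
  then show "F \<subseteq> fixed_field K \<sigma> \<and> (\<forall>x\<in>carrier K. L (\<sigma> x) = \<ominus> L x)"
    using L\<beta>_bilinear_iff L_\<sigma>_eq_neg_if_L\<beta>_alternating by (auto simp: alternating_form_def)
next
  assume *: "F \<subseteq> fixed_field K \<sigma> \<and> (\<forall>x\<in>carrier K. L (\<sigma> x) = \<ominus> L x)"
  have "L (\<beta> x x) = \<zero>" if x: "x \<in> carrier V" for x
  proof -
    \<comment> \<open>\<beta>(x,x) is fixed by \<sigma>, since \<beta> is hermitian. Applying
      L\<sigma> = -L to it directly would only give 2 L\<beta>(x,x) = 0, which says nothing in
      characteristic two; writing it as a trace covers every characteristic.\<close>
    obtain z where z: "z \<in> carrier K" "\<beta> x x = z \<oplus> \<sigma> z"
      using fixed_by_involution_is_trace[OF involution, of "\<beta> x x"] x by auto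
    then have "L (\<beta> x x) = L z \<oplus> \<ominus> L z"
      using * by (simp add: L_add)
    then show ?thesis
      using z(1) by (simp add: r_neg)
  qed
  then show "alternating_form K\<^sub>F V L\<beta>"
    using * L\<beta>_bilinear_iff by (simp add: alternating_form_def)
qed

end

section \<open>The type of \<open>L\<beta>\<close> in each case\<close>

theorem theoremB:
  fixes K :: "('a, 'm) ring_scheme" and F :: "'a set"
    and V :: "('a, 'b, 'n) module_scheme"
    and \<sigma> L :: "'a \<Rightarrow> 'a" and \<beta> :: "'b \<Rightarrow> 'b \<Rightarrow> 'a"
  defines "K\<^sub>F \<equiv> K\<lparr>carrier := F\<rparr>"
    and "L\<beta> \<equiv> \<lambda>u v. L (\<beta> u v)"
  assumes "field K" and "subfield F K" and "module K V"
    and "sesquilinear_form K V \<sigma> \<beta>" and "reflexive_form K V \<beta>"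
    and "alternating_form K V \<beta> \<or> symmetric_form K V \<beta> \<or> hermitian_form K V \<sigma> \<beta>"
    and "hermitian_form K V \<sigma> \<beta> \<longrightarrow> \<sigma> ` F = F"
    and "linear_functional K F L" and "\<exists>x\<in>carrier K. L x \<noteq> \<zero>\<^bsub>K\<^esub>"
  shows "(alternating_form K V \<beta> \<longrightarrow> alternating_form K\<^sub>F V L\<beta>) \<and>
    (symmetric_form K V \<beta> \<longrightarrow> symmetric_form K\<^sub>F V L\<beta>) \<and>
    (characteristic K = 2 \<and> finite (carrier K) \<and> symmetric_form K V \<beta> \<and> \<not> alternating_form K V \<beta> \<longrightarrow>
       symmetric_form K\<^sub>F V L\<beta> \<and> \<not> alternating_form K\<^sub>F V L\<beta>) \<and>
    (hermitian_form K V \<sigma> \<beta> \<and> nonzero_form K V \<beta> \<and> \<not> F \<subseteq> fixed_field K \<sigma> \<longrightarrow>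
       (hermitian_form K\<^sub>F V \<sigma> L\<beta> \<longleftrightarrow> (\<forall>x\<in>carrier K. L (\<sigma> x) = \<sigma> (L x))) \<and>
       (atypical_form K\<^sub>F V \<sigma> L\<beta> \<longleftrightarrow> \<not> (\<forall>x\<in>carrier K. L (\<sigma> x) = \<sigma> (L x)))) \<and>
    (hermitian_form K V \<sigma> \<beta> \<and> nonzero_form K V \<beta> \<and> F \<subseteq> fixed_field K \<sigma> \<longrightarrow>
       (symmetric_form K\<^sub>F V L\<beta> \<longleftrightarrow> (\<forall>x\<in>carrier K. L (\<sigma> x) = L x)) \<and>
       (alternating_form K\<^sub>F V L\<beta> \<longleftrightarrow>
          (characteristic K \<noteq> 2 \<and> (\<forall>x\<in>carrier K. L (\<sigma> x) = \<ominus>\<^bsub>K\<^esub> L x)) \<or>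
          (characteristic K = 2 \<and> (\<forall>x\<in>carrier K. L (\<sigma> x) = L x))) \<and>
       (atypical_form K\<^sub>F V \<sigma> L\<beta> \<longleftrightarrow>
          \<not> (\<forall>x\<in>carrier K. L (\<sigma> x) = L x) \<and>
          \<not> (\<forall>x\<in>carrier K. L (\<sigma> x) = \<ominus>\<^bsub>K\<^esub> L x)))"
proof -
  interpret form_functional K V F L
    using assms by (simp add: form_functional_def form_functional_axioms_def)
  have 1: "alternating_form K V \<beta> \<longrightarrow> alternating_form K\<^sub>F V L\<beta>"
    and 2: "symmetric_form K V \<beta> \<longrightarrow> symmetric_form K\<^sub>F V L\<beta>"
    using L_comp_alternating L_comp_symmetric unfolding K\<^sub>F_def L\<beta>_def by blast+
  have 3: "characteristic K = 2 \<and> finite (carrier K) \<and> symmetric_form K V \<beta> \<and>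
      \<not> alternating_form K V \<beta> \<longrightarrow> \<not> alternating_form K\<^sub>F V L\<beta>"
    using L_comp_not_alternating_char2 unfolding K\<^sub>F_def L\<beta>_def by blast
  \<comment> \<open>The criteria hold whether or not \<sigma> fixes \<open>F\<close> pointwise. If
    it does not, \<open>L\<beta>\<close> can be neither symmetric nor alternating; if it does,
    \<open>L\<beta>\<close> cannot be hermitian. Being atypical thus reduces to the failure of the
    criteria that remain.\<close>
  have 4: "hermitian_form K V \<sigma> \<beta> \<and> nonzero_form K V \<beta> \<longrightarrow>
      sesquilinear_form K\<^sub>F V \<sigma> L\<beta> \<and>
      (hermitian_form K\<^sub>F V \<sigma> L\<beta> \<longleftrightarrow>
        \<not> F \<subseteq> fixed_field K \<sigma> \<and> (\<forall>x\<in>carrier K. L (\<sigma> x) = \<sigma> (L x))) \<and>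
      (symmetric_form K\<^sub>F V L\<beta> \<longleftrightarrow>
        F \<subseteq> fixed_field K \<sigma> \<and> (\<forall>x\<in>carrier K. L (\<sigma> x) = L x)) \<and>
      (alternating_form K\<^sub>F V L\<beta> \<longleftrightarrow>
        F \<subseteq> fixed_field K \<sigma> \<and> (\<forall>x\<in>carrier K. L (\<sigma> x) = \<ominus>\<^bsub>K\<^esub> L x))"
    (is "_ \<longrightarrow> ?types")
  proof
    assume "hermitian_form K V \<sigma> \<beta> \<and> nonzero_form K V \<beta>"
    then interpret H: hermitian_form_functional K V F L \<sigma> \<beta>
      using assms form_functional_axioms
      by (simp add: hermitian_form_functional_def hermitian_form_functional_axioms_def)
    show ?types
      unfolding K\<^sub>F_def L\<beta>_def
      by (intro conjI H.L\<beta>_sesquilinear H.L\<beta>_hermitian_iff H.L\<beta>_symmetric_iff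
          H.L\<beta>_alternating_iff)
  qed
  \<comment> \<open>The single criterion L\<sigma> = -L for alternating forms is stated in the
    theorem as a split by characteristic; in characteristic two the sign disappears.\<close>
  have 5: "characteristic K = 2 \<longrightarrow>
      ((\<forall>x\<in>carrier K. L (\<sigma> x) = \<ominus>\<^bsub>K\<^esub> L x) \<longleftrightarrow> (\<forall>x\<in>carrier K. L (\<sigma> x) = L x))"
    by (simp add: minus_eq_self_char2)
  show ?thesis
    unfolding atypical_form_def using 1 2 3 4 5 by argo
qed

end
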